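(* Let $V[p,q]$ be the restriction to $[p,q]$ (where $1\le p\le q\le n$) of a finite-dimensional zigzag module $V$ of length $n$ over a field $K$. Let $V[p,q]=\bigoplus_{\alpha\in A}J_\alpha$ be an interval decomposition and let $U=I[p,q]$. Then: (1) There exists a monomorphism $U\to V[p,q]$ if and only if the supports of the admissible interval summands $J_\alpha$ cover $[p,q]$. (2) There exists a nonsplitting monomorphism $U\to V[p,q]$ if and only if the supports of the proper admissible interval summands $J_\alpha$ cover $[p,q]$.
   Context: Let $K$ be a field. A zigzag module $V$ of length $n$ over $K$ consists of finite-dimensional $K$-vector spaces $V_1,\dots,V_n$ together with, for each $1\le i<n$, exactly one linear map, either $V_i\to V_{i+1}$ (a forward arrow) or $V_i\leftarrow V_{i+1}$ (a backward arrow). The sequence of arrow directions is the zigzag type; it is fixed and all modules compared have the same type. Morphisms are families of linear maps commuting with the structure maps; a monomorphism is a morphism that is injective at every vertex. A monomorphism splits if it admits a retraction, equivalently if its image is a direct summand; otherwise it is nonsplitting. For $p\le q$, the restriction $V[p,q]$ keeps only the vector spaces and arrows with indices between $p$ and $q$. Intervals $[b,d]$ are discrete (sets of integers). The interval module $I[b,d]$ (support $[b,d]$) has $I[b,d]_i=K$ for $b\le i\le d$ and $0$ otherwise, with identity maps between consecutive nonzero spaces and zero maps otherwise. An interval decomposition of $V[p,q]$ is a finite direct sum decomposition $V[p,q]=\bigoplus_{\alpha\in A}J_\alpha$ into submodules each isomorphic to an interval module $I[b,d]$ with $p\le b\le d\le q$; the $J_\alpha$ are the interval summands. An interval summand $J\cong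 I[b,d]$ is proper (relative to $[p,q]$) if $[b,d]\subsetneq[p,q]$, equivalently $J\not\cong I[p,q]$. It is admissible if $\operatorname{Hom}(I[p,q],J)\neq 0$. *)

theory Defs
  imports Complex_Main "HOL-Library.FuncSet"
begin

text \<open>
  The vector spaces of a zigzag module are subspaces of a common ambient vector space: a type
  \<open>'v\<close> with scalar multiplication \<open>s\<close> over the field \<open>'k\<close>. This is no restriction, since finitely
  many vector spaces embed into their direct sum. The vertices form the integer interval
  \<open>{first_vertex..last_vertex}\<close>; values of \<open>vspace\<close> and \<open>arrow\<close> outside the relevant range are junk
  and are ignored by all definitions.
\<close>

datatype direction = Forward | Backward

text \<open>A zigzag type assigns to \<open>i\<close> the direction of the arrow between the vertices \<open>i\<close> and \<open>Suc i\<close>.\<close>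

type_synonym zigzag_type = "nat \<Rightarrow> direction"

definition src :: "zigzag_type \<Rightarrow> nat \<Rightarrow> nat" where
  "src \<tau> i = (case \<tau> i of Forward \<Rightarrow> i | Backward \<Rightarrow> Suc i)"

definition tgt :: "zigzag_type \<Rightarrow> nat \<Rightarrow> nat" where
  "tgt \<tau> i = (case \<tau> i of Forward \<Rightarrow> Suc i | Backward \<Rightarrow> i)"

record 'v zigzag =
  first_vertex :: nat
  last_vertex :: nat
  vspace :: "nat \<Rightarrow> 'v set"
  arrow :: "nat \<Rightarrow> 'v \<Rightarrow> 'v"

abbreviation vertices :: "'v zigzag \<Rightarrow> nat set" where
  "vertices M \<equiv> {first_vertex M..last_vertex M}"

abbreviation arrows :: "'v zigzag \<Rightarrow> nat set" where
  "arrows M \<equiv> {first_vertex M..<last_vertex M}"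

definition linear_map_on ::
  "('k::field \<Rightarrow> 'v::ab_group_add \<Rightarrow> 'v) \<Rightarrow> ('k \<Rightarrow> 'w::ab_group_add \<Rightarrow> 'w) \<Rightarrow>
   'v set \<Rightarrow> 'w set \<Rightarrow> ('v \<Rightarrow> 'w) \<Rightarrow> bool" where
  "linear_map_on s t A B f \<longleftrightarrow>
     f ` A \<subseteq> B \<and>
     (\<forall>x\<in>A. \<forall>y\<in>A. f (x + y) = f x + f y) \<and>
     (\<forall>c. \<forall>x\<in>A. f (s c x) = t c (f x))"

definition finite_dim_subspace ::
  "('k::field \<Rightarrow> 'v::ab_group_add \<Rightarrow> 'v) \<Rightarrow> 'v set \<Rightarrow> bool" where
  "finite_dim_subspace s S \<longleftrightarrow>
     module.subspace s S \<and> (\<exists>B. finite B \<and> module.span s B = S)"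

definition zigzag_module ::
  "('k::field \<Rightarrow> 'v::ab_group_add \<Rightarrow> 'v) \<Rightarrow> zigzag_type \<Rightarrow> 'v zigzag \<Rightarrow> bool" where
  "zigzag_module s \<tau> M \<longleftrightarrow>
     vector_space s \<and>
     (\<forall>i\<in>vertices M. finite_dim_subspace s (vspace M i)) \<and>
     (\<forall>i\<in>arrows M. linear_map_on s s (vspace M (src \<tau> i)) (vspace M (tgt \<tau> i)) (arrow M i))"

definition zigzag_module_of_length ::
  "('k::field \<Rightarrow> 'v::ab_group_add \<Rightarrow> 'v) \<Rightarrow> zigzag_type \<Rightarrow> nat \<Rightarrow> 'v zigzag \<Rightarrow> bool" where
  "zigzag_module_of_length s \<tau> n V \<longleftrightarrow> zigzag_module s \<tau> V \<and> first_vertex V = 1 \<and> last_vertex V = n"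

definition zigzag_restriction :: "'v zigzag \<Rightarrow> nat \<Rightarrow> nat \<Rightarrow> 'v zigzag" where
  "zigzag_restriction V p q = V\<lparr>first_vertex := p, last_vertex := q\<rparr>"

text \<open>
  \<open>interval_module p q b d\<close> is $I[b,d]$ as a module with vertex set \<open>{p..q}\<close>. Its ambient vector
  space is the field itself, with scalar multiplication \<open>(*)\<close>.
\<close>

definition interval_module :: "nat \<Rightarrow> nat \<Rightarrow> nat \<Rightarrow> nat \<Rightarrow> 'k::field zigzag" where
  "interval_module p q b d =
     \<lparr>first_vertex = p, last_vertex = q,
      vspace = (\<lambda>i. if b \<le> i \<and> i \<le> d then UNIV else {0}),
      arrow = (\<lambda>i x. if b \<le> i \<and> Suc i \<le> d then x else 0)\<rparr>"

definition morphism ::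
  "('k::field \<Rightarrow> 'v::ab_group_add \<Rightarrow> 'v) \<Rightarrow> ('k \<Rightarrow> 'w::ab_group_add \<Rightarrow> 'w) \<Rightarrow> zigzag_type \<Rightarrow>
   'v zigzag \<Rightarrow> 'w zigzag \<Rightarrow> (nat \<Rightarrow> 'v \<Rightarrow> 'w) \<Rightarrow> bool" where
  "morphism s t \<tau> M N \<phi> \<longleftrightarrow>
     first_vertex M = first_vertex N \<and> last_vertex M = last_vertex N \<and>
     (\<forall>i\<in>vertices M. linear_map_on s t (vspace M i) (vspace N i) (\<phi> i)) \<and>
     (\<forall>i\<in>arrows M. \<forall>x\<in>vspace M (src \<tau> i).
        \<phi> (tgt \<tau> i) (arrow M i x) = arrow N i (\<phi> (src \<tau> i) x))"

definition monomorphism ::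
  "('k::field \<Rightarrow> 'v::ab_group_add \<Rightarrow> 'v) \<Rightarrow> ('k \<Rightarrow> 'w::ab_group_add \<Rightarrow> 'w) \<Rightarrow> zigzag_type \<Rightarrow>
   'v zigzag \<Rightarrow> 'w zigzag \<Rightarrow> (nat \<Rightarrow> 'v \<Rightarrow> 'w) \<Rightarrow> bool" where
  "monomorphism s t \<tau> M N \<phi> \<longleftrightarrow>
     morphism s t \<tau> M N \<phi> \<and> (\<forall>i\<in>vertices M. inj_on (\<phi> i) (vspace M i))"

definition left_inverse_of :: "'v zigzag \<Rightarrow> (nat \<Rightarrow> 'w \<Rightarrow> 'v) \<Rightarrow> (nat \<Rightarrow> 'v \<Rightarrow> 'w) \<Rightarrow> bool" where
  "left_inverse_of M \<rho> \<phi> \<longleftrightarrow> (\<forall>i\<in>vertices M. \<forall>x\<in>vspace M i. \<rho> i (\<phi> i x) = x)"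

definition splits ::
  "('k::field \<Rightarrow> 'v::ab_group_add \<Rightarrow> 'v) \<Rightarrow> ('k \<Rightarrow> 'w::ab_group_add \<Rightarrow> 'w) \<Rightarrow> zigzag_type \<Rightarrow>
   'v zigzag \<Rightarrow> 'w zigzag \<Rightarrow> (nat \<Rightarrow> 'v \<Rightarrow> 'w) \<Rightarrow> bool" where
  "splits s t \<tau> M N \<phi> \<longleftrightarrow> (\<exists>\<rho>. morphism t s \<tau> N M \<rho> \<and> left_inverse_of M \<rho> \<phi>)"

definition isomorphic ::
  "('k::field \<Rightarrow> 'v::ab_group_add \<Rightarrow> 'v) \<Rightarrow> ('k \<Rightarrow> 'w::ab_group_add \<Rightarrow> 'w) \<Rightarrow> zigzag_type \<Rightarrow>
   'v zigzag \<Rightarrow> 'w zigzag \<Rightarrow> bool" where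
  "isomorphic s t \<tau> M N \<longleftrightarrow>
     (\<exists>\<phi> \<psi>. morphism s t \<tau> M N \<phi> \<and> morphism t s \<tau> N M \<psi> \<and>
        left_inverse_of M \<psi> \<phi> \<and> left_inverse_of N \<phi> \<psi>)"

text \<open>
  Morphisms are only relevant on the spaces of their domain, so a morphism represents the zero
  morphism if it vanishes there.
\<close>

definition nonzero_Hom ::
  "('k::field \<Rightarrow> 'v::ab_group_add \<Rightarrow> 'v) \<Rightarrow> ('k \<Rightarrow> 'w::ab_group_add \<Rightarrow> 'w) \<Rightarrow> zigzag_type \<Rightarrow>
   'v zigzag \<Rightarrow> 'w zigzag \<Rightarrow> bool" where
  "nonzero_Hom s t \<tau> M N \<longleftrightarrow>
     (\<exists>\<phi>. morphism s t \<tau> M N \<phi> \<and> (\<exists>i\<in>vertices M. \<exists>x\<in>vspace M i. \<phi> i x \<noteq> 0))"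

definition zigzag_submodule ::
  "('k::field \<Rightarrow> 'v::ab_group_add \<Rightarrow> 'v) \<Rightarrow> zigzag_type \<Rightarrow> 'v zigzag \<Rightarrow> 'v zigzag \<Rightarrow> bool" where
  "zigzag_submodule s \<tau> J M \<longleftrightarrow>
     first_vertex J = first_vertex M \<and> last_vertex J = last_vertex M \<and>
     (\<forall>i\<in>vertices M. module.subspace s (vspace J i) \<and> vspace J i \<subseteq> vspace M i) \<and>
     (\<forall>i\<in>arrows M. \<forall>x\<in>vspace J (src \<tau> i).
        arrow J i x = arrow M i x \<and> arrow M i x \<in> vspace J (tgt \<tau> i))"

definition direct_sum_decomposition ::
  "('k::field \<Rightarrow> 'v::ab_group_add \<Rightarrow> 'v) \<Rightarrow> zigzag_type \<Rightarrow> 'v zigzag \<Rightarrow>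
   'a set \<Rightarrow> ('a \<Rightarrow> 'v zigzag) \<Rightarrow> bool" where
  "direct_sum_decomposition s \<tau> M A J \<longleftrightarrow>
     finite A \<and>
     (\<forall>\<alpha>\<in>A. zigzag_submodule s \<tau> (J \<alpha>) M) \<and>
     (\<forall>i\<in>vertices M. \<forall>x\<in>vspace M i.
        \<exists>!f. f \<in> (\<Pi>\<^sub>E \<alpha>\<in>A. vspace (J \<alpha>) i) \<and> x = (\<Sum>\<alpha>\<in>A. f \<alpha>))"

definition is_interval ::
  "('k::field \<Rightarrow> 'v::ab_group_add \<Rightarrow> 'v) \<Rightarrow> zigzag_type \<Rightarrow> 'v zigzag \<Rightarrow> nat \<Rightarrow> nat \<Rightarrow> bool" where
  "is_interval s \<tau> J b d \<longleftrightarrow>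
     first_vertex J \<le> b \<and> b \<le> d \<and> d \<le> last_vertex J \<and>
     isomorphic s (*) \<tau> J (interval_module (first_vertex J) (last_vertex J) b d)"

definition interval_decomposition ::
  "('k::field \<Rightarrow> 'v::ab_group_add \<Rightarrow> 'v) \<Rightarrow> zigzag_type \<Rightarrow> 'v zigzag \<Rightarrow>
   'a set \<Rightarrow> ('a \<Rightarrow> 'v zigzag) \<Rightarrow> bool" where
  "interval_decomposition s \<tau> M A J \<longleftrightarrow>
     direct_sum_decomposition s \<tau> M A J \<and> (\<forall>\<alpha>\<in>A. \<exists>b d. is_interval s \<tau> (J \<alpha>) b d)"

definition zigzag_support :: "'v::ab_group_add zigzag \<Rightarrow> nat set" where
  "zigzag_support M = {i \<in> vertices M. vspace M i \<noteq> {0}}"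

definition proper_summand ::
  "('k::field \<Rightarrow> 'v::ab_group_add \<Rightarrow> 'v) \<Rightarrow> zigzag_type \<Rightarrow> 'v zigzag \<Rightarrow> bool" where
  "proper_summand s \<tau> J \<longleftrightarrow> (\<exists>b d. is_interval s \<tau> J b d \<and> {b..d} \<subset> vertices J)"

definition admissible_summand ::
  "('k::field \<Rightarrow> 'v::ab_group_add \<Rightarrow> 'v) \<Rightarrow> zigzag_type \<Rightarrow> 'v zigzag \<Rightarrow> bool" where
  "admissible_summand s \<tau> J \<longleftrightarrow>
     nonzero_Hom (*) s \<tau> (interval_module (first_vertex J) (last_vertex J) (first_vertex J) (last_vertex J)) J"

lemma vector_space_field: "vector_space ((*) :: 'k::field \<Rightarrow> 'k \<Rightarrow> 'k)"
  by unfold_locales (simp_all add: algebra_simps)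

lemma zigzag_module_interval_module:
  "zigzag_module (*) \<tau> (interval_module p q b d :: 'k::field zigzag)"
proof -
  interpret vector_space "(*) :: 'k \<Rightarrow> 'k \<Rightarrow> 'k" by (rule vector_space_field)
  have "UNIV = span {1 :: 'k}"
    by (auto simp: span_singleton)
  then have "finite_dim_subspace (*) (UNIV :: 'k set)"
    unfolding finite_dim_subspace_def by (metis finite.emptyI finite.insertI subspace_UNIV)
  moreover have "finite_dim_subspace (*) {0 :: 'k}"
    unfolding finite_dim_subspace_def by (metis finite.emptyI span_empty subspace_single_0)
  ultimately show ?thesis
    by (auto simp: zigzag_module_def interval_module_def linear_map_on_def src_def tgt_def
        vector_space_field split: direction.split)
qed

lemma zigzag_module_restriction:
  assumes "zigzag_module_of_length s \<tau> n V" "1 \<le> p" "p \<le> q" "q \<le> n"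
  shows "zigzag_module s \<tau> (zigzag_restriction V p q)"
  using assms by (auto simp: zigzag_module_of_length_def zigzag_module_def zigzag_restriction_def)

lemma support_interval_module:
  assumes "p \<le> b" "d \<le> q"
  shows "zigzag_support (interval_module p q b d :: 'k::field zigzag) = {b..d}"
proof -
  have "(UNIV :: 'k set) \<noteq> {0}" by (metis UNIV_I singletonD zero_neq_one)
  then show ?thesis using assms by (auto simp: zigzag_support_def interval_module_def)
qed

end

theory Submission
  imports Defs
begin

text \<open>
  A morphism out of \<open>U = I[p,q]\<close> is a compatible family of vectors, and it splits into its
  components \<open>U \<rightarrow> J \<alpha>\<close>. A morphism from \<open>U\<close> to an interval module is constant on the support, so
  it is either zero or nonzero on the whole support. Hence a monomorphism forces the supports of
  the admissible summands to cover \<open>[p,q]\<close>, and conversely the sum of one nonzero morphism for each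
  of these summands is a monomorphism. If a component of \<open>\<phi>\<close> at a summand isomorphic to \<open>U\<close> is
  nonzero, it is an isomorphism and yields a retraction of \<open>\<phi>\<close>. If all components go to proper
  summands, no retraction exists: an endomorphism of \<open>U\<close> that factors through a proper summand
  vanishes at some vertex and is therefore zero.
\<close>

section \<open>Linear maps on subspaces and composition of morphisms\<close>

lemma linear_map_on_zero:
  fixes f :: "'v::ab_group_add \<Rightarrow> 'w::ab_group_add"
  assumes "linear_map_on s t A B f" "0 \<in> A"
  shows "f 0 = 0"
proof -
  have "f (0 + 0) = f 0 + f 0"
    using assms unfolding linear_map_on_def by blast
  then show ?thesis by simp
qed

lemma linear_map_on_sum:
  assumes "vector_space s" "module.subspace s S" "linear_map_on s t S B f"
    and "\<And>x. x \<in> X \<Longrightarrow> g x \<in> S"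
  shows "f (\<Sum>x\<in>X. g x) = (\<Sum>x\<in>X. f (g x))"
proof -
  interpret vector_space s by fact
  have "0 \<in> S" using assms(2) by (rule subspace_0)
  then have z: "f 0 = 0" using assms(3) by (rule linear_map_on_zero[rotated])
  show ?thesis
    using assms(4)
  proof (induction X rule: infinite_finite_induct)
    case (insert x X)
    then have "g x \<in> S" "sum g X \<in> S" by (auto intro: subspace_sum[OF assms(2)])
    then have "f (g x + sum g X) = f (g x) + f (sum g X)"
      using assms(3) by (auto simp: linear_map_on_def)
    then show ?case using insert by auto
  \<comment> \<open>A sum over an empty or infinite index set is 0, so the remaining cases reduce to
    \<open>f 0 = 0\<close>.\<close>
  qed (simp_all add: z)
qed

lemma src_tgt_vertices:
  assumes "i \<in> arrows M"
  shows "src \<tau> i \<in> vertices M" "tgt \<tau> i \<in> vertices M"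
  using assms by (auto simp: src_def tgt_def split: direction.split)

lemma morphism_comp:
  assumes "morphism s t \<tau> L M \<phi>" "morphism t u \<tau> M N \<psi>"
  shows "morphism s u \<tau> L N (\<lambda>i x. \<psi> i (\<phi> i x))"
proof -
  have eq: "first_vertex L = first_vertex M" "last_vertex L = last_vertex M"
    using assms(1) by (simp_all add: morphism_def)
  have "\<phi> i x \<in> vspace M i" if "i \<in> vertices L" "x \<in> vspace L i" for i x
    using assms(1) that unfolding morphism_def linear_map_on_def by blast
  moreover have "src \<tau> i \<in> vertices L" if "i \<in> arrows L" for i
    using that by (rule src_tgt_vertices)
  ultimately show ?thesis
    using assms unfolding morphism_def linear_map_on_def eq by (simp add: image_subset_iff)
qed

lemma morphism_zero:
  assumes "morphism s t \<tau> M N \<phi>" "i \<in> vertices M" "0 \<in> vspace M i"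
  shows "\<phi> i 0 = 0"
  using assms linear_map_on_zero unfolding morphism_def by blast

section \<open>Morphisms from I[p,q] to interval modules\<close>

lemma interval_module_sel [simp]:
  "first_vertex (interval_module p q b d) = p"
  "last_vertex (interval_module p q b d) = q"
  "vspace (interval_module p q b d) i = (if b \<le> i \<and> i \<le> d then UNIV else {0})"
  "arrow (interval_module p q b d) i x = (if b \<le> i \<and> Suc i \<le> d then x else 0)"
  by (simp_all add: interval_module_def)

text \<open>The space of I[p,q] at \<open>i\<close> is the field, spanned by 1. Hence the vectors
  \<open>\<phi> i 1\<close> determine the morphism, and later arguments follow only the image of
  1.\<close>

lemma morphism_interval_scale:
  assumes "morphism (*) s \<tau> (interval_module p q p q) M \<phi>" "i \<in> {p..q}"
  shows "\<phi> i c = s c (\<phi> i 1)"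
proof -
  have "linear_map_on (*) s UNIV (vspace M i) (\<phi> i)"
    using assms by (auto simp: morphism_def)
  then have "\<phi> i (c * 1) = s c (\<phi> i 1)" unfolding linear_map_on_def by blast
  then show ?thesis by simp
qed

text \<open>Between neighbouring vertices of \<open>{b..d}\<close> both modules have identity maps,
  so the commuting square forces equal images of 1, whatever the direction of the arrow.\<close>

lemma morphism_interval_constant:
  assumes \<phi>: "morphism (*) (*) \<tau> (interval_module p q p q) (interval_module p q b d) \<phi>"
    and "p \<le> b" "d \<le> q" "i \<in> {b..d}" "j \<in> {b..d}"
  shows "\<phi> i (1 :: 'k::field) = (\<phi> j 1 :: 'k)"
proof -
  have step: "\<phi> (Suc l) 1 = \<phi> l 1" if "b \<le> l" "Suc l \<le> d" for l
  proof -
    have "\<phi> (tgt \<tau> l) 1 = \<phi> (src \<tau> l) 1"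
      using \<phi> that assms(2,3) src_tgt_vertices[of l "interval_module p q p q" \<tau>]
      by (auto simp: morphism_def)
    then show ?thesis by (auto simp: src_def tgt_def split: direction.splits)
  qed
  have base: "\<phi> l 1 = \<phi> b 1" if "b \<le> l" "l \<le> d" for l
    using that by (induction l rule: dec_induct) (use step in auto)
  show ?thesis using base[of i] base[of j] assms(4,5) by simp
qed

text \<open>Extracts the isomorphism in the form that makes \<open>\<theta>\<close> reflect zero: if
  \<open>\<theta> i x = 0\<close>, then
  \<open>x = \<psi> i (\<theta> i x) = \<psi> i 0 = 0\<close>.\<close>

lemma is_interval_isoE:
  assumes "is_interval s \<tau> N b d"
  obtains \<theta> \<psi> where
    "morphism s (*) \<tau> N (interval_module (first_vertex N) (last_vertex N) b d) \<theta>"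
    "morphism (*) s \<tau> (interval_module (first_vertex N) (last_vertex N) b d) N \<psi>"
    "\<And>i x. i \<in> vertices N \<Longrightarrow> x \<in> vspace N i \<Longrightarrow> \<psi> i (\<theta> i x) = x"
    "\<And>i. i \<in> vertices N \<Longrightarrow> \<psi> i 0 = 0"
    "first_vertex N \<le> b" "b \<le> d" "d \<le> last_vertex N"
proof -
  let ?I = "interval_module (first_vertex N) (last_vertex N) b d :: 'a zigzag"
  obtain \<theta> \<psi> where *: "morphism s (*) \<tau> N ?I \<theta>" "morphism (*) s \<tau> ?I N \<psi>"
    "left_inverse_of N \<psi> \<theta>"
    using assms by (auto simp: is_interval_def isomorphic_def)
  have "\<psi> i 0 = 0" if "i \<in> vertices N" for i
    using *(2) by (rule morphism_zero) (use that in auto)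
  with * assms show thesis
    by (intro that[of \<theta> \<psi>]) (auto simp: left_inverse_of_def is_interval_def)
qed

lemma is_interval_vspace_outside:
  assumes "is_interval s \<tau> N b d" "i \<in> vertices N" "i \<notin> {b..d}"
  shows "vspace N i \<subseteq> {0}"
proof
  fix x assume x: "x \<in> vspace N i"
  from assms(1) obtain \<theta> \<psi> where
    \<theta>: "morphism s (*) \<tau> N (interval_module (first_vertex N) (last_vertex N) b d) \<theta>"
    and inv: "\<And>i x. i \<in> vertices N \<Longrightarrow> x \<in> vspace N i \<Longrightarrow> \<psi> i (\<theta> i x) = x"
    and "\<And>i. i \<in> vertices N \<Longrightarrow> \<psi> i 0 = 0"
    by (rule is_interval_isoE) metis
  moreover have "\<theta> i x = 0"
  proof -
    have "linear_map_on s (*) (vspace N i) (if b \<le> i \<and> i \<le> d then UNIV else {0}) (\<theta> i)"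
      using \<theta> assms(2) by (simp add: morphism_def)
    then show ?thesis using x assms(3) by (auto simp: linear_map_on_def)
  qed
  ultimately show "x \<in> {0}" using x assms(2) by (metis singletonI)
qed

text \<open>Composing \<open>\<phi>\<close> with the isomorphism from \<open>N\<close> to I[b,d]
  gives a morphism between interval modules, which is constant on \<open>{b..d}\<close>. Both
  \<open>i\<close> and \<open>j\<close> lie there, so nonvanishing passes from \<open>i\<close> to
  \<open>j\<close>; scaling passes between 1 and the scalars \<open>c\<close> and
  \<open>a\<close>.\<close>

lemma nonzero_on_support:
  fixes s :: "'k::field \<Rightarrow> 'v::ab_group_add \<Rightarrow> 'v"
  assumes s: "vector_space s" and N: "is_interval s \<tau> N b d"
    and \<phi>: "morphism (*) s \<tau> (interval_module (first_vertex N) (last_vertex N)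
               (first_vertex N) (last_vertex N)) N \<phi>"
    and i: "i \<in> vertices N" "\<phi> i c \<noteq> 0"
    and j: "j \<in> zigzag_support N" and "a \<noteq> 0"
  shows "\<phi> j a \<noteq> 0"
proof -
  interpret vector_space s by fact
  obtain \<theta> \<psi> where
    \<theta>: "morphism s (*) \<tau> N (interval_module (first_vertex N) (last_vertex N) b d) \<theta>"
    and inv: "\<And>i x. i \<in> vertices N \<Longrightarrow> x \<in> vspace N i \<Longrightarrow> \<psi> i (\<theta> i x) = x"
    and \<psi>0: "\<And>i. i \<in> vertices N \<Longrightarrow> \<psi> i 0 = 0"
    and bd: "first_vertex N \<le> b" "d \<le> last_vertex N"
    using N by (rule is_interval_isoE) metis
  have mem: "\<phi> l x \<in> vspace N l" if "l \<in> vertices N" for l x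
  proof -
    have "linear_map_on (*) s UNIV (vspace N l) (\<phi> l)"
      using \<phi> that by (auto simp: morphism_def)
    then show ?thesis by (auto simp: linear_map_on_def)
  qed
  have 1: "\<phi> i 1 \<noteq> 0"
    using i morphism_interval_scale[OF \<phi>, of i c] by auto
  then have \<theta>i: "\<theta> i (\<phi> i 1) \<noteq> 0"
    using inv[OF i(1) mem[OF i(1)]] \<psi>0[OF i(1)] by metis
  have ibd: "i \<in> {b..d}"
    using 1 is_interval_vspace_outside[OF N i(1)] mem[OF i(1)] by blast
  have jN: "j \<in> vertices N" using j by (auto simp: zigzag_support_def)
  \<comment> \<open>The support only asks that the space differ from \<open>{0}\<close>. Membership
    of 0 rules out the empty set, so that a space contained in \<open>{0}\<close> equals it.\<close>
  have "0 \<in> vspace N j" using mem[OF jN, of 0] morphism_interval_scale[OF \<phi> jN, of 0] by simp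
  then have jbd: "j \<in> {b..d}"
    using j is_interval_vspace_outside[OF N jN] by (auto simp: zigzag_support_def)
  have "\<theta> j (\<phi> j 1) = \<theta> i (\<phi> i 1)"
    using morphism_interval_constant[OF morphism_comp[OF \<phi> \<theta>] bd jbd ibd] .
  moreover have "linear_map_on s (*) (vspace N j) UNIV (\<theta> j)"
    using \<theta> jN by (auto simp: morphism_def linear_map_on_def)
  ultimately have "\<phi> j 1 \<noteq> 0"
    using \<theta>i linear_map_on_zero \<open>0 \<in> vspace N j\<close> by metis
  then show ?thesis
    using morphism_interval_scale[OF \<phi> jN, of a] \<open>a \<noteq> 0\<close> by simp
qed

lemma is_interval_full_if_not_proper:
  assumes "is_interval s \<tau> N b d" "\<not> proper_summand s \<tau> N"
  shows "is_interval s \<tau> N (first_vertex N) (last_vertex N)"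
proof -
  have "first_vertex N \<le> b" "b \<le> d" "d \<le> last_vertex N"
    using assms(1) by (auto simp: is_interval_def)
  moreover have "{b..d} = vertices N"
    using assms calculation by (fastforce simp: proper_summand_def)
  \<comment> \<open>Since \<open>b \<le> d\<close>, the intervals are nonempty, and equality of the
    sets gives equality of the endpoints.\<close>
  ultimately have "b = first_vertex N" "d = last_vertex N"
    by auto
  then show ?thesis using assms(1) by simp
qed

section \<open>Coordinates and projections of a direct sum decomposition\<close>

locale decomposed_zigzag =
  fixes s :: "'k::field \<Rightarrow> 'v::ab_group_add \<Rightarrow> 'v"
    and \<tau> :: zigzag_type and M :: "'v zigzag" and A :: "'a set" and J :: "'a \<Rightarrow> 'v zigzag"
  assumes zmod: "zigzag_module s \<tau> M"
    and dec: "direct_sum_decomposition s \<tau> M A J"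
begin

sublocale vector_space s
  using zmod by (simp add: zigzag_module_def)

lemma finite_index: "finite A"
  using dec by (simp add: direct_sum_decomposition_def)

lemma summand_ends:
  assumes "\<alpha> \<in> A"
  shows "first_vertex (J \<alpha>) = first_vertex M" "last_vertex (J \<alpha>) = last_vertex M"
  using dec assms by (auto simp: direct_sum_decomposition_def zigzag_submodule_def)

lemma subspace_vspace:
  assumes "i \<in> vertices M"
  shows "subspace (vspace M i)"
  using zmod assms by (auto simp: zigzag_module_def finite_dim_subspace_def)

lemma summand_subspace:
  assumes "\<alpha> \<in> A" "i \<in> vertices M"
  shows "subspace (vspace (J \<alpha>) i)" "vspace (J \<alpha>) i \<subseteq> vspace M i"
  using dec assms by (auto simp: direct_sum_decomposition_def zigzag_submodule_def)

lemma summand_arrow: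
  assumes "\<alpha> \<in> A" "i \<in> arrows M" "x \<in> vspace (J \<alpha>) (src \<tau> i)"
  shows "arrow (J \<alpha>) i x = arrow M i x" "arrow M i x \<in> vspace (J \<alpha>) (tgt \<tau> i)"
  using dec assms by (auto simp: direct_sum_decomposition_def zigzag_submodule_def)

lemma arrow_linear:
  assumes "i \<in> arrows M"
  shows "linear_map_on s s (vspace M (src \<tau> i)) (vspace M (tgt \<tau> i)) (arrow M i)"
  using zmod assms by (auto simp: zigzag_module_def)

lemma inclusion_morphism:
  assumes "\<alpha> \<in> A"
  shows "morphism s s \<tau> (J \<alpha>) M (\<lambda>i x. x)"
  using assms summand_ends[OF assms] summand_subspace[OF assms] summand_arrow[OF assms]
  by (auto simp: morphism_def linear_map_on_def)

lemma sum_summands_mem: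
  assumes "i \<in> vertices M" "B \<subseteq> A" "\<And>\<alpha>. \<alpha> \<in> B \<Longrightarrow> f \<alpha> \<in> vspace (J \<alpha>) i"
  shows "(\<Sum>\<alpha>\<in>B. f \<alpha>) \<in> vspace M i"
  using assms summand_subspace by (intro subspace_sum subspace_vspace) blast+

text \<open>The components of \<open>x\<close> at vertex \<open>i\<close>. The description is unique
  when \<open>x\<close> lies in the space of \<open>M\<close> at \<open>i\<close>; other values are
  junk.\<close>

definition coords :: "nat \<Rightarrow> 'v \<Rightarrow> 'a \<Rightarrow> 'v" where
  "coords i x = (THE f. f \<in> (\<Pi>\<^sub>E \<alpha>\<in>A. vspace (J \<alpha>) i) \<and> x = (\<Sum>\<alpha>\<in>A. f \<alpha>))"

lemma coords:
  assumes "i \<in> vertices M" "x \<in> vspace M i"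
  shows "\<And>\<alpha>. \<alpha> \<in> A \<Longrightarrow> coords i x \<alpha> \<in> vspace (J \<alpha>) i" "(\<Sum>\<alpha>\<in>A. coords i x \<alpha>) = x"
proof -
  have "\<exists>!f. f \<in> (\<Pi>\<^sub>E \<alpha>\<in>A. vspace (J \<alpha>) i) \<and> x = (\<Sum>\<alpha>\<in>A. f \<alpha>)"
    using dec assms by (simp add: direct_sum_decomposition_def)
  from theI'[OF this]
  have *: "coords i x \<in> (\<Pi>\<^sub>E \<alpha>\<in>A. vspace (J \<alpha>) i)" "x = (\<Sum>\<alpha>\<in>A. coords i x \<alpha>)"
    by (simp_all add: coords_def)
  show "coords i x \<alpha> \<in> vspace (J \<alpha>) i" if "\<alpha> \<in> A" for \<alpha>
    using *(1) that by auto
  show "(\<Sum>\<alpha>\<in>A. coords i x \<alpha>) = x" using *(2) by simp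
qed

text \<open>Uniqueness of the decomposition as a rule for computing components: it suffices to
  exhibit a family in the summands with sum \<open>x\<close>.\<close>

lemma coords_eqI:
  assumes i: "i \<in> vertices M" and f: "\<And>\<alpha>. \<alpha> \<in> A \<Longrightarrow> f \<alpha> \<in> vspace (J \<alpha>) i"
    and x: "x = (\<Sum>\<alpha>\<in>A. f \<alpha>)" and \<alpha>: "\<alpha> \<in> A"
  shows "coords i x \<alpha> = f \<alpha>"
proof -
  have xM: "x \<in> vspace M i" using sum_summands_mem[OF i order_refl] f x by simp
  have "\<exists>!g. g \<in> (\<Pi>\<^sub>E \<alpha>\<in>A. vspace (J \<alpha>) i) \<and> x = (\<Sum>\<alpha>\<in>A. g \<alpha>)"
    using dec i xM by (simp add: direct_sum_decomposition_def)
  \<comment> \<open>Uniqueness is stated for extensional functions, so both families are first cut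
    down to \<open>A\<close>.\<close>
  moreover have "restrict (coords i x) A \<in> (\<Pi>\<^sub>E \<alpha>\<in>A. vspace (J \<alpha>) i)"
    "x = sum (restrict (coords i x) A) A"
    using coords[OF i xM] by auto
  moreover have "restrict f A \<in> (\<Pi>\<^sub>E \<alpha>\<in>A. vspace (J \<alpha>) i)" "x = sum (restrict f A) A"
    using f x by auto
  ultimately have "restrict (coords i x) A = restrict f A" by blast
  then show ?thesis using \<alpha> by (metis restrict_apply')
qed

text \<open>Sums, multiples and arrow images of component families are again families in the
  summands with the right total, so uniqueness identifies them as the components.\<close>

lemma projection_morphism:
  assumes \<alpha>: "\<alpha> \<in> A"
  shows "morphism s s \<tau> M (J \<alpha>) (\<lambda>i x. coords i x \<alpha>)"
  unfolding morphism_def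
proof (intro conjI ballI)
  fix i assume i: "i \<in> vertices M"
  have "coords i (x + y) \<alpha> = coords i x \<alpha> + coords i y \<alpha>"
    if "x \<in> vspace M i" "y \<in> vspace M i" for x y
    using i that \<alpha> by (intro coords_eqI)
      (auto simp: sum.distrib coords intro!: subspace_add[OF summand_subspace(1)])
  moreover have "coords i (s c x) \<alpha> = s c (coords i x \<alpha>)" if "x \<in> vspace M i" for c x
    using i that \<alpha> by (intro coords_eqI)
      (auto simp: scale_sum_right[symmetric] coords intro!: subspace_scale[OF summand_subspace(1)])
  ultimately show "linear_map_on s s (vspace M i) (vspace (J \<alpha>) i) (\<lambda>x. coords i x \<alpha>)"
    using i \<alpha> coords by (auto simp: linear_map_on_def)
next
  fix i x assume i: "i \<in> arrows M" and x: "x \<in> vspace M (src \<tau> i)"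
  note st = src_tgt_vertices[OF i, of \<tau>]
  have "arrow M i (\<Sum>\<alpha>\<in>A. coords (src \<tau> i) x \<alpha>) = (\<Sum>\<alpha>\<in>A. arrow M i (coords (src \<tau> i) x \<alpha>))"
    using coords[OF st(1) x] summand_subspace(2)[OF _ st(1)]
    by (intro linear_map_on_sum[OF vector_space_axioms subspace_vspace[OF st(1)] arrow_linear[OF i]]) blast
  \<comment> \<open>The arrow maps each summand into itself, so the images of the components form a
    valid family at the target.\<close>
  then have "coords (tgt \<tau> i) (arrow M i x) \<alpha> = arrow M i (coords (src \<tau> i) x \<alpha>)"
    using coords[OF st(1) x] summand_arrow[OF _ i] \<alpha>
    by (intro coords_eqI[OF st(2)]) auto
  then show "coords (tgt \<tau> i) (arrow M i x) \<alpha> = arrow (J \<alpha>) i (coords (src \<tau> i) x \<alpha>)"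
    using summand_arrow(1)[OF \<alpha> i] coords(1)[OF st(1) x \<alpha>] by simp
qed (simp_all add: summand_ends[OF \<alpha>])

section \<open>Morphisms from U into the direct sum\<close>

abbreviation full_interval :: "'k zigzag" where
  "full_interval \<equiv> interval_module (first_vertex M) (last_vertex M) (first_vertex M) (last_vertex M)"

lemma morphism_full_mem:
  assumes "morphism (*) s \<tau> full_interval N \<phi>" "i \<in> vertices M"
  shows "\<phi> i c \<in> vspace N i"
proof -
  have "linear_map_on (*) s UNIV (vspace N i) (\<phi> i)"
    using assms by (auto simp: morphism_def)
  then show ?thesis by (auto simp: linear_map_on_def)
qed

lemma sum_morphism:
  assumes B: "B \<subseteq> A" and \<phi>: "\<And>\<alpha>. \<alpha> \<in> B \<Longrightarrow> morphism (*) s \<tau> full_interval (J \<alpha>) (\<phi> \<alpha>)"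
  shows "morphism (*) s \<tau> full_interval M (\<lambda>i c. \<Sum>\<alpha>\<in>B. \<phi> \<alpha> i c)"
proof -
  have mem: "\<phi> \<alpha> i c \<in> vspace (J \<alpha>) i" if "\<alpha> \<in> B" "i \<in> vertices M" for \<alpha> i c
    using that \<phi> morphism_full_mem by blast
  have lin: "linear_map_on (*) s UNIV (vspace (J \<alpha>) i) (\<phi> \<alpha> i)" if "\<alpha> \<in> B" "i \<in> vertices M" for \<alpha> i
    using \<phi>[OF that(1)] that(2) by (auto simp: morphism_def)
  have 1: "linear_map_on (*) s UNIV (vspace M i) (\<lambda>c. \<Sum>\<alpha>\<in>B. \<phi> \<alpha> i c)" if i: "i \<in> vertices M" for i
    using sum_summands_mem[OF i B mem[OF _ i]] lin[OF _ i]
    by (auto simp: linear_map_on_def sum.distrib[symmetric] scale_sum_right intro!: sum.cong)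
  have 2: "(\<Sum>\<alpha>\<in>B. \<phi> \<alpha> (tgt \<tau> i) c) = arrow M i (\<Sum>\<alpha>\<in>B. \<phi> \<alpha> (src \<tau> i) c)" if i: "i \<in> arrows M" for i c
  proof -
    note st = src_tgt_vertices[OF i, of \<tau>]
    have "\<phi> \<alpha> (tgt \<tau> i) c = arrow M i (\<phi> \<alpha> (src \<tau> i) c)" if "\<alpha> \<in> B" for \<alpha>
    proof -
      have "\<phi> \<alpha> (tgt \<tau> i) (arrow full_interval i c) = arrow (J \<alpha>) i (\<phi> \<alpha> (src \<tau> i) c)"
        using \<phi>[OF that] i st unfolding morphism_def by simp
      then show ?thesis
        using i summand_arrow(1)[OF _ i mem[OF that st(1)]] that B by auto
    qed
    moreover have "arrow M i (\<Sum>\<alpha>\<in>B. \<phi> \<alpha> (src \<tau> i) c) = (\<Sum>\<alpha>\<in>B. arrow M i (\<phi> \<alpha> (src \<tau> i) c))"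
      using mem[OF _ st(1)] summand_subspace(2)[OF _ st(1)] B
      by (intro linear_map_on_sum[OF vector_space_axioms subspace_vspace[OF st(1)] arrow_linear[OF i]]) blast
    ultimately show ?thesis by simp
  qed
  show ?thesis
    unfolding morphism_def using 1 2 by simp
qed

text \<open>Directness of the sum: the values, extended by 0 from \<open>B\<close> to
  \<open>A\<close>, form a decomposition of 0, and so does the zero family.\<close>

lemma sum_morphism_eq_zero:
  assumes B: "B \<subseteq> A" and \<phi>: "\<And>\<alpha>. \<alpha> \<in> B \<Longrightarrow> morphism (*) s \<tau> full_interval (J \<alpha>) (\<phi> \<alpha>)"
    and i: "i \<in> vertices M" and zero: "(\<Sum>\<alpha>\<in>B. \<phi> \<alpha> i c) = 0" and \<beta>: "\<beta> \<in> B"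
  shows "\<phi> \<beta> i c = 0"
proof -
  let ?f = "\<lambda>\<alpha>. if \<alpha> \<in> B then \<phi> \<alpha> i c else 0"
  have "coords i 0 \<beta> = ?f \<beta>"
  proof (rule coords_eqI[OF i])
    show "0 = sum ?f A"
      using zero B finite_index by (simp add: sum.If_cases Int_absorb1)
    show "?f \<alpha> \<in> vspace (J \<alpha>) i" if "\<alpha> \<in> A" for \<alpha>
      using that i \<phi> morphism_full_mem subspace_0[OF summand_subspace(1)] by auto
  qed (use \<beta> B in auto)
  moreover have "coords i 0 \<beta> = 0"
    using i \<beta> B by (intro coords_eqI[where f = "\<lambda>_. 0"]) (auto intro: subspace_0[OF summand_subspace(1)])
  ultimately show ?thesis using \<beta> by simp
qed

lemma component_nonzero:
  assumes "i \<in> vertices M" "x \<in> vspace M i" "x \<noteq> 0"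
  obtains \<alpha> where "\<alpha> \<in> A" "coords i x \<alpha> \<noteq> 0"
  using coords(2)[OF assms(1,2)] assms(3) by (metis sum.neutral)

text \<open>The composite of \<open>\<phi>\<close> with the projection to \<open>J \<alpha>\<close>
  is a nonzero morphism from U, and its value at \<open>i\<close> is a nonzero vector of
  \<open>J \<alpha>\<close>.\<close>

lemma component_admissible:
  assumes \<phi>: "morphism (*) s \<tau> full_interval M \<phi>" and "\<alpha> \<in> A" "i \<in> vertices M"
    and nz: "coords i (\<phi> i c) \<alpha> \<noteq> 0"
  shows "admissible_summand s \<tau> (J \<alpha>)" "i \<in> zigzag_support (J \<alpha>)"
proof -
  note m = morphism_comp[OF \<phi> projection_morphism[OF \<open>\<alpha> \<in> A\<close>]]
  show "admissible_summand s \<tau> (J \<alpha>)"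
    unfolding admissible_summand_def nonzero_Hom_def summand_ends[OF \<open>\<alpha> \<in> A\<close>]
    using m nz \<open>i \<in> vertices M\<close> by fastforce
  show "i \<in> zigzag_support (J \<alpha>)"
    using morphism_full_mem[OF m \<open>i \<in> vertices M\<close>, of c] nz summand_ends[OF \<open>\<alpha> \<in> A\<close>] assms(3)
    by (auto simp: zigzag_support_def)
qed

lemma monomorphism_nonzero:
  assumes "monomorphism (*) s \<tau> full_interval M \<phi>" "i \<in> vertices M"
  shows "\<phi> i 1 \<noteq> 0"
proof -
  have "\<phi> i 0 = 0"
    using assms by (intro morphism_zero[of "(*)" s \<tau> full_interval M]) (auto simp: monomorphism_def)
  moreover have "inj (\<phi> i)" using assms by (auto simp: monomorphism_def)
  ultimately show ?thesis by (metis injD zero_neq_one)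
qed

text \<open>The monomorphism is returned together with its components, because the proof that it
  does not split works component by component.\<close>

lemma monomorphism_of_cover:
  assumes interval: "\<And>\<alpha>. \<alpha> \<in> A \<Longrightarrow> \<exists>b d. is_interval s \<tau> (J \<alpha>) b d"
    and B: "B \<subseteq> A" "\<And>\<alpha>. \<alpha> \<in> B \<Longrightarrow> admissible_summand s \<tau> (J \<alpha>)"
    and cover: "vertices M \<subseteq> (\<Union>\<alpha>\<in>B. zigzag_support (J \<alpha>))"
  obtains \<phi> where "\<And>\<alpha>. \<alpha> \<in> B \<Longrightarrow> morphism (*) s \<tau> full_interval (J \<alpha>) (\<phi> \<alpha>)"
    "monomorphism (*) s \<tau> full_interval M (\<lambda>i c. \<Sum>\<alpha>\<in>B. \<phi> \<alpha> i c)"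
proof -
  have "\<forall>\<alpha>\<in>B. \<exists>\<phi>. morphism (*) s \<tau> full_interval (J \<alpha>) \<phi> \<and> (\<exists>i\<in>vertices M. \<exists>c. \<phi> i c \<noteq> 0)"
  proof
    fix \<alpha> assume "\<alpha> \<in> B"
    with B show "\<exists>\<phi>. morphism (*) s \<tau> full_interval (J \<alpha>) \<phi> \<and> (\<exists>i\<in>vertices M. \<exists>c. \<phi> i c \<noteq> 0)"
      using summand_ends[of \<alpha>] unfolding admissible_summand_def nonzero_Hom_def by fastforce
  qed
  then obtain \<phi> where \<phi>: "\<And>\<alpha>. \<alpha> \<in> B \<Longrightarrow> morphism (*) s \<tau> full_interval (J \<alpha>) (\<phi> \<alpha>)"
    and nz: "\<And>\<alpha>. \<alpha> \<in> B \<Longrightarrow> \<exists>i\<in>vertices M. \<exists>c. \<phi> \<alpha> i c \<noteq> 0"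
    by metis
  let ?\<Phi> = "\<lambda>i c. \<Sum>\<alpha>\<in>B. \<phi> \<alpha> i c"
  have m: "morphism (*) s \<tau> full_interval M ?\<Phi>" using B(1) \<phi> by (rule sum_morphism)
  \<comment> \<open>If the sum vanishes at \<open>c\<close>, so does each component. But some
    summand has \<open>i\<close> in its support, and its component is nonzero at every nonzero
    scalar there.\<close>
  have kernel: "c = 0" if i: "i \<in> vertices M" and c: "?\<Phi> i c = 0" for i c
  proof (rule ccontr)
    assume "c \<noteq> 0"
    obtain \<alpha> where \<alpha>: "\<alpha> \<in> B" "i \<in> zigzag_support (J \<alpha>)" using cover i by blast
    note ends = summand_ends[OF subsetD[OF B(1) \<alpha>(1)]]
    obtain b d where "is_interval s \<tau> (J \<alpha>) b d" using interval \<alpha>(1) B(1) by blast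
    moreover obtain j a where "j \<in> vertices M" "\<phi> \<alpha> j a \<noteq> 0" using nz[OF \<alpha>(1)] by blast
    ultimately have "\<phi> \<alpha> i c \<noteq> 0"
      using \<phi>[OF \<alpha>(1)] \<alpha>(2) \<open>c \<noteq> 0\<close>
      by (intro nonzero_on_support[OF vector_space_axioms, of \<tau> "J \<alpha>" b d]) (auto simp: ends)
    then show False using sum_morphism_eq_zero[OF B(1) \<phi> i c \<alpha>(1)] by simp
  qed
  have "inj_on (?\<Phi> i) UNIV" if i: "i \<in> vertices M" for i
  proof (rule inj_onI)
    fix x y assume "?\<Phi> i x = ?\<Phi> i y"
    then have "?\<Phi> i (x - y) = 0"
      using morphism_interval_scale[OF m i] by (metis scale_left_diff_distrib right_minus_eq)
    then show "x = y" using kernel[OF i] by fastforce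
  qed
  then have "monomorphism (*) s \<tau> full_interval M ?\<Phi>"
    using m by (auto simp: monomorphism_def)
  with \<phi> show thesis by (rule that)
qed

section \<open>Splitting and nonsplitting\<close>

text \<open>Here \<open>\<phi>\<close>, the projection to \<open>J \<alpha>\<close> and the
  isomorphism from \<open>J \<alpha>\<close> to U compose to an endomorphism of U. It is
  multiplication by one scalar \<open>k\<close> at all vertices, and \<open>k\<close> is nonzero
  because the component is.\<close>

lemma splits_of_full_component:
  assumes \<phi>: "morphism (*) s \<tau> full_interval M \<phi>" and \<alpha>: "\<alpha> \<in> A"
    and full: "is_interval s \<tau> (J \<alpha>) (first_vertex M) (last_vertex M)"
    and i: "i \<in> vertices M" and nz: "coords i (\<phi> i 1) \<alpha> \<noteq> 0"
  shows "splits (*) s \<tau> full_interval M \<phi>"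
proof -
  note pr = projection_morphism[OF \<alpha>]
  note ends = summand_ends[OF \<alpha>]
  from full obtain \<theta> \<psi> where \<theta>: "morphism s (*) \<tau> (J \<alpha>) full_interval \<theta>"
    and inv: "\<And>i x. i \<in> vertices M \<Longrightarrow> x \<in> vspace (J \<alpha>) i \<Longrightarrow> \<psi> i (\<theta> i x) = x"
    and \<psi>0: "\<And>i. i \<in> vertices M \<Longrightarrow> \<psi> i 0 = 0"
    by (rule is_interval_isoE) (metis ends)
  define k where "k = \<theta> i (coords i (\<phi> i 1) \<alpha>)"
  have "coords i (\<phi> i 1) \<alpha> \<in> vspace (J \<alpha>) i"
    using i \<alpha> morphism_full_mem[OF \<phi>] coords by blast
  then have k: "k \<noteq> 0"
    unfolding k_def using inv[OF i] \<psi>0[OF i] nz by metis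
  note \<eta> = morphism_comp[OF \<phi> morphism_comp[OF pr \<theta>]]
  \<comment> \<open>Dividing by \<open>k\<close> turns the projection followed by the isomorphism
    into a retraction.\<close>
  let ?\<rho> = "\<lambda>j x. \<theta> j (coords j x \<alpha>) / k"
  have "?\<rho> j (\<phi> j c) = c" if j: "j \<in> vertices M" for j c
  proof -
    have "\<theta> j (coords j (\<phi> j 1) \<alpha>) = k"
      unfolding k_def using morphism_interval_constant[OF \<eta> order_refl order_refl j i] .
    then show ?thesis using morphism_interval_scale[OF \<eta> j, of c] k by simp
  qed
  moreover have "morphism s (*) \<tau> M full_interval ?\<rho>"
    using morphism_comp[OF pr \<theta>] src_tgt_vertices[of _ M \<tau>]
    by (auto simp: morphism_def linear_map_on_def add_divide_distrib)
  ultimately show ?thesis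
    unfolding splits_def left_inverse_of_def by (intro exI[of _ ?\<rho>]) simp
qed

text \<open>The composite from U through \<open>J \<alpha>\<close> and \<open>M\<close> back to U
  sends 1 to the same scalar at every vertex. A vertex \<open>j\<close> outside
  \<open>{b..d}\<close>, where \<open>J \<alpha>\<close> is zero, shows that this scalar is
  0.\<close>

lemma proper_factor_zero:
  assumes \<alpha>: "\<alpha> \<in> A" "proper_summand s \<tau> (J \<alpha>)"
    and \<phi>: "morphism (*) s \<tau> full_interval (J \<alpha>) \<phi>"
    and \<rho>: "morphism s (*) \<tau> M full_interval \<rho>" and i: "i \<in> vertices M"
  shows "\<rho> i (\<phi> i 1) = 0"
proof -
  note ends = summand_ends[OF \<alpha>(1)]
  obtain b d j where bd: "is_interval s \<tau> (J \<alpha>) b d" and j: "j \<in> vertices M" "j \<notin> {b..d}"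
    using \<alpha>(2) unfolding proper_summand_def ends by blast
  have "\<phi> j 1 = 0"
    using is_interval_vspace_outside[OF bd] j morphism_full_mem[OF \<phi> j(1), of 1] by (auto simp: ends)
  moreover have "\<rho> j 0 = 0"
    using \<rho> j(1) subspace_0[OF subspace_vspace[OF j(1)]] by (rule morphism_zero)
  moreover have "\<rho> i (\<phi> i 1) = \<rho> j (\<phi> j 1)"
    using morphism_interval_constant[OF
        morphism_comp[OF \<phi> morphism_comp[OF inclusion_morphism[OF \<alpha>(1)] \<rho>]]
        order_refl order_refl i j(1)] .
  ultimately show ?thesis by simp
qed

text \<open>At the vertex \<open>i\<close> a retraction would send the image of 1 to 1; by linearity
  it also sends it to a sum of terms that vanish by \<open>proper_factor_zero\<close>.\<close>

lemma sum_proper_not_splits: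
  assumes B: "B \<subseteq> A" "\<And>\<alpha>. \<alpha> \<in> B \<Longrightarrow> proper_summand s \<tau> (J \<alpha>)"
    and \<phi>: "\<And>\<alpha>. \<alpha> \<in> B \<Longrightarrow> morphism (*) s \<tau> full_interval (J \<alpha>) (\<phi> \<alpha>)"
    and i: "i \<in> vertices M"
  shows "\<not> splits (*) s \<tau> full_interval M (\<lambda>i c. \<Sum>\<alpha>\<in>B. \<phi> \<alpha> i c)"
proof
  assume "splits (*) s \<tau> full_interval M (\<lambda>i c. \<Sum>\<alpha>\<in>B. \<phi> \<alpha> i c)"
  then obtain \<rho> where \<rho>: "morphism s (*) \<tau> M full_interval \<rho>"
    and inv: "\<rho> i (\<Sum>\<alpha>\<in>B. \<phi> \<alpha> i 1) = 1"
    using i unfolding splits_def left_inverse_of_def by auto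
  have "linear_map_on s (*) (vspace M i) (vspace full_interval i) (\<rho> i)"
    using \<rho> i by (simp add: morphism_def)
  then have "\<rho> i (\<Sum>\<alpha>\<in>B. \<phi> \<alpha> i 1) = (\<Sum>\<alpha>\<in>B. \<rho> i (\<phi> \<alpha> i 1))"
    using B(1) summand_subspace(2)[OF _ i] morphism_full_mem[OF \<phi> i]
    by (intro linear_map_on_sum[OF vector_space_axioms subspace_vspace[OF i]]) blast+
  also have "\<dots> = 0"
    using B proper_factor_zero[OF _ _ \<phi> \<rho> i] by (intro sum.neutral) blast
  finally show False using inv by simp
qed

end

section \<open>Both covering criteria for V[p,q]\<close>

theorem proposition3p11:
  fixes s :: "'k::field \<Rightarrow> 'v::ab_group_add \<Rightarrow> 'v"
    and \<tau> :: zigzag_type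
    and n p q :: nat
    and V :: "'v zigzag"
    and A :: "'a set"
    and J :: "'a \<Rightarrow> 'v zigzag"
    and U :: "'k zigzag"
  assumes "zigzag_module_of_length s \<tau> n V"
    and "1 \<le> p" and "p \<le> q" and "q \<le> n"
    and "interval_decomposition s \<tau> (zigzag_restriction V p q) A J"
    and "U = interval_module p q p q"
  shows "((\<exists>\<phi>. monomorphism (*) s \<tau> U (zigzag_restriction V p q) \<phi>) \<longleftrightarrow>
            {p..q} \<subseteq> (\<Union>\<alpha>\<in>{\<alpha>\<in>A. admissible_summand s \<tau> (J \<alpha>)}. zigzag_support (J \<alpha>))) \<and>
         ((\<exists>\<phi>. monomorphism (*) s \<tau> U (zigzag_restriction V p q) \<phi> \<and>
               \<not> splits (*) s \<tau> U (zigzag_restriction V p q) \<phi>) \<longleftrightarrow>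
            {p..q} \<subseteq> (\<Union>\<alpha>\<in>{\<alpha>\<in>A. proper_summand s \<tau> (J \<alpha>) \<and> admissible_summand s \<tau> (J \<alpha>)}.
                         zigzag_support (J \<alpha>)))"
proof -
  define M where "M = zigzag_restriction V p q"
  have ends: "first_vertex M = p" "last_vertex M = q"
    by (simp_all add: M_def zigzag_restriction_def)
  have int: "\<exists>b d. is_interval s \<tau> (J \<alpha>) b d" if "\<alpha> \<in> A" for \<alpha>
    using assms(5) that by (auto simp: interval_decomposition_def)
  interpret decomposed_zigzag s \<tau> M A J
    using zigzag_module_restriction[OF assms(1-4)] assms(5)
    by unfold_locales (auto simp: M_def interval_decomposition_def)
  have U: "U = full_interval" by (simp add: assms(6) ends)
  let ?B = "{\<alpha>\<in>A. admissible_summand s \<tau> (J \<alpha>)}"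
  let ?P = "{\<alpha>\<in>A. proper_summand s \<tau> (J \<alpha>) \<and> admissible_summand s \<tau> (J \<alpha>)}"
  \<comment> \<open>By injectivity the image of 1 is nonzero at each vertex, so it has a nonzero
    component in some summand.\<close>
  have component: "\<exists>\<alpha>\<in>A. coords i (\<phi> i 1) \<alpha> \<noteq> 0"
    if "monomorphism (*) s \<tau> U M \<phi>" "i \<in> vertices M" for \<phi> i
  proof -
    have "\<phi> i 1 \<in> vspace M i" "\<phi> i 1 \<noteq> 0"
      using that morphism_full_mem[of M \<phi> i] monomorphism_nonzero[of \<phi> i]
      unfolding U monomorphism_def by blast+
    with that(2) show ?thesis by (blast elim: component_nonzero)
  qed
  have "(\<exists>\<phi>. monomorphism (*) s \<tau> U M \<phi>) \<longleftrightarrow> vertices M \<subseteq> (\<Union>\<alpha>\<in>?B. zigzag_support (J \<alpha>))"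
  proof
    assume "\<exists>\<phi>. monomorphism (*) s \<tau> U M \<phi>"
    then obtain \<phi> where \<phi>: "monomorphism (*) s \<tau> U M \<phi>" ..
    then have m: "morphism (*) s \<tau> full_interval M \<phi>" by (simp add: monomorphism_def U)
    show "vertices M \<subseteq> (\<Union>\<alpha>\<in>?B. zigzag_support (J \<alpha>))"
    proof
      fix i assume i: "i \<in> vertices M"
      obtain \<alpha> where \<alpha>: "\<alpha> \<in> A" "coords i (\<phi> i 1) \<alpha> \<noteq> 0" using component[OF \<phi> i] by blast
      then show "i \<in> (\<Union>\<alpha>\<in>?B. zigzag_support (J \<alpha>))"
        using component_admissible[OF m \<alpha>(1) i \<alpha>(2)] by blast
    qed
  next
    assume cover: "vertices M \<subseteq> (\<Union>\<alpha>\<in>?B. zigzag_support (J \<alpha>))"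
    show "\<exists>\<phi>. monomorphism (*) s \<tau> U M \<phi>"
      unfolding U by (rule monomorphism_of_cover[OF int _ _ cover]) blast+
  qed
  moreover have "(\<exists>\<phi>. monomorphism (*) s \<tau> U M \<phi> \<and> \<not> splits (*) s \<tau> U M \<phi>) \<longleftrightarrow>
      vertices M \<subseteq> (\<Union>\<alpha>\<in>?P. zigzag_support (J \<alpha>))"
  proof
    assume "\<exists>\<phi>. monomorphism (*) s \<tau> U M \<phi> \<and> \<not> splits (*) s \<tau> U M \<phi>"
    then obtain \<phi> where \<phi>: "monomorphism (*) s \<tau> U M \<phi>" "\<not> splits (*) s \<tau> U M \<phi>" by blast
    then have m: "morphism (*) s \<tau> full_interval M \<phi>" by (simp add: monomorphism_def U)
    show "vertices M \<subseteq> (\<Union>\<alpha>\<in>?P. zigzag_support (J \<alpha>))"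
    proof
      fix i assume i: "i \<in> vertices M"
      obtain \<alpha> where \<alpha>: "\<alpha> \<in> A" "coords i (\<phi> i 1) \<alpha> \<noteq> 0" using component[OF \<phi>(1) i] by blast
      \<comment> \<open>Otherwise \<open>J \<alpha>\<close> would be isomorphic to U, and the
        nonzero component would make \<phi> split.\<close>
      have "proper_summand s \<tau> (J \<alpha>)"
        using splits_of_full_component[OF m \<alpha>(1) _ i \<alpha>(2)] \<phi>(2) int[OF \<alpha>(1)]
          is_interval_full_if_not_proper[of s \<tau> "J \<alpha>"]
        unfolding U summand_ends[OF \<alpha>(1)] by blast
      then show "i \<in> (\<Union>\<alpha>\<in>?P. zigzag_support (J \<alpha>))"
        using component_admissible[OF m \<alpha>(1) i \<alpha>(2)] \<alpha>(1) by blast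
    qed
  next
    assume cover: "vertices M \<subseteq> (\<Union>\<alpha>\<in>?P. zigzag_support (J \<alpha>))"
    \<comment> \<open>Supplies a vertex at which a supposed retraction is refuted.\<close>
    have p: "p \<in> vertices M" using assms(3) by (simp add: ends)
    obtain \<phi> where \<phi>: "\<And>\<alpha>. \<alpha> \<in> ?P \<Longrightarrow> morphism (*) s \<tau> full_interval (J \<alpha>) (\<phi> \<alpha>)"
      and mono: "monomorphism (*) s \<tau> full_interval M (\<lambda>i c. \<Sum>\<alpha>\<in>?P. \<phi> \<alpha> i c)"
      by (rule monomorphism_of_cover[OF int _ _ cover]) auto
    have "\<not> splits (*) s \<tau> full_interval M (\<lambda>i c. \<Sum>\<alpha>\<in>?P. \<phi> \<alpha> i c)"
      by (rule sum_proper_not_splits[OF _ _ \<phi> p]) auto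
    with mono show "\<exists>\<phi>. monomorphism (*) s \<tau> U M \<phi> \<and> \<not> splits (*) s \<tau> U M \<phi>"
      unfolding U by blast
  qed
  \<comment> \<open>The equations \<open>ends\<close> speak of \<open>M\<close>, so they are applied
    before \<open>M\<close> is unfolded.\<close>
  ultimately show ?thesis unfolding ends unfolding M_def by (rule conjI)
qed

end
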